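(* For each $n \ge 1$ let a median $k_n$ be defined by the relation $$k_n = \inf\{x \in \mathbb{Z} : F_n(x) \le 1/2\},$$ and let $a_n = G^{k_n}(F_n(k_n))$. Then $$\lim_{n\to\infty} \sup_{x\in\mathbb{Z}} |F_n(x) - \mathcal{F}^{a_n}(x)| = 0.$$
   Context: Let $\mathbb{T}$ be the infinite rooted binary tree (every vertex has exactly two children); $|u|$ denotes the level of a vertex $u$ (the root has level $0$). To the edges of $\mathbb{T}$ associate i.i.d. symmetric Bernoulli random variables $B_i$ with $\mathbb{P}(B_i=1)=\mathbb{P}(B_i=-1)=\frac12$. For a vertex $u$, $V(u)$ is the sum of the variables on the edges of the path connecting $u$ with the root (so $V(\text{root})=0$). Let $M_n := \max\{V(u) : |u| = n\}$ and $M_n' := \frac{n-M_n}{2}$, which is a non-negative integer random variable with values in $[0,n]$. Let $F_n(x) := \mathbb{P}(M_n' \ge x)$ for $x\in\mathbb{Z}$. Equivalently, $F_0(x)=1$ for $x\le 0$, $F_0(x)=0$ for $x>0$, and $F_{n+1}(x) = \left[\frac{F_n(x)+F_n(x-1)}{2}\right]^2$. Let $g(y) := 2-y-2\sqrt{1-y}$ and $G(y) := 2\sqrt{y}-y$, which are mutually inverse functions on $[0,1]$; $g^n$ and $G^n$ denote their $n$-th iterates (compositions). For $0<a<1$ define $\mathcal{F}^a:\mathbb{Z}\to(0,1)$ by $$\mathcal{F}^a(m) = \begin{cases} g^m(a), & m>0,\\ a, & m=0,\\ G^{|m|}(a), & m<0.\end{cases}$$ (These are tail functions of distributions on $\mathbb{Z}$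 that are invariant: $4\mathcal{F}^a(x) = [\mathcal{F}^a(x)+\mathcal{F}^a(x-1)]^2$.) *)

theory Defs
  imports "HOL-Probability.Probability"
begin

text \<open>
  The vertices of the infinite rooted binary tree are the finite Boolean words: the root is the
  empty word, the children of \<open>u\<close> are \<open>u @ [False]\<close> and \<open>u @ [True]\<close>, and the level of \<open>u\<close> is
  \<open>length u\<close>. An edge is named by its endpoint farther from the root, so the edges are the
  nonempty words and those on the path from the root to \<open>u\<close> are the nonempty prefixes of \<open>u\<close>.
\<close>

definition tree_edges :: "bool list set" where
  "tree_edges = {e. e \<noteq> []}"

definition position :: "(bool list \<Rightarrow> 'w \<Rightarrow> real) \<Rightarrow> bool list \<Rightarrow> 'w \<Rightarrow> real" where
  "position B u \<omega> = (\<Sum>i=1..length u. B (take i u) \<omega>)"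

definition max_position :: "(bool list \<Rightarrow> 'w \<Rightarrow> real) \<Rightarrow> nat \<Rightarrow> 'w \<Rightarrow> real" where
  "max_position B n \<omega> = Max {position B u \<omega> | u. length u = n}"

definition max_defect :: "(bool list \<Rightarrow> 'w \<Rightarrow> real) \<Rightarrow> nat \<Rightarrow> 'w \<Rightarrow> real" where
  "max_defect B n \<omega> = (real n - max_position B n \<omega>) / 2"

definition tail :: "'w measure \<Rightarrow> (bool list \<Rightarrow> 'w \<Rightarrow> real) \<Rightarrow> nat \<Rightarrow> int \<Rightarrow> real" where
  "tail M B n x = measure M {\<omega> \<in> space M. max_defect B n \<omega> \<ge> real_of_int x}"

definition g :: "real \<Rightarrow> real" where
  "g y = 2 - y - 2 * sqrt (1 - y)"

definition G :: "real \<Rightarrow> real" where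
  "G y = 2 * sqrt y - y"

text \<open>Only meant for \<open>0 < a < 1\<close>.\<close>

definition invariant_tail :: "real \<Rightarrow> int \<Rightarrow> real" where
  "invariant_tail a m =
    (if m > 0 then (g ^^ nat m) a else if m = 0 then a else (G ^^ nat \<bar>m\<bar>) a)"

definition tail_median :: "'w measure \<Rightarrow> (bool list \<Rightarrow> 'w \<Rightarrow> real) \<Rightarrow> nat \<Rightarrow> int" where
  "tail_median M B n = Inf {x::int. tail M B n x \<le> 1/2}"

text \<open>
  For a symmetric Bernoulli family the set in the definition of the median contains \<open>n + 1\<close> and no
  \<open>x \<le> 0\<close>, so its infimum is attained and positive: the conversion by \<open>nat\<close> below loses nothing.
\<close>

definition tail_param :: "'w measure \<Rightarrow> (bool list \<Rightarrow> 'w \<Rightarrow> real) \<Rightarrow> nat \<Rightarrow> real" where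
  "tail_param M B n = (G ^^ nat (tail_median M B n)) (tail M B n (tail_median M B n))"

end

theory Submission
  imports Defs
begin

text \<open>
  Splitting the tree at the root turns the tails \<open>F\<^sub>n\<close> into a deterministic recursion,
  \<open>F\<^sub>n\<^sub>+\<^sub>1(x) = ((F\<^sub>n(x) + F\<^sub>n(x - 1)) / 2)\<^sup>2\<close>, whose stationary solutions with values
  in the unit interval are the orbits of \<open>g\<close>: stationarity of \<open>F\<close> at \<open>x\<close> says \<open>F(x) = g(F(x - 1))\<close>, or equivalently \<open>F(x - 1) = G(F(x))\<close>.
  So everything follows once the increments \<open>F\<^sub>n\<^sub>+\<^sub>1(x) - F\<^sub>n(x)\<close> tend to 0 uniformly in \<open>x\<close>: then \<open>F\<^sub>n\<close>
  is nearly stationary, hence follows the orbit through its value at the median for any fixed number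
  of steps, and beyond finitely many steps both the orbit and \<open>F\<^sub>n\<close> are close to 0 or to 1.

  The uniform decay of the increments \<open>D\<^sub>n\<close> is the heart of the matter. They satisfy
  \<open>D\<^sub>n\<^sub>+\<^sub>1(x) \<le> s (D\<^sub>n(x) + D\<^sub>n(x - 1))\<close> with \<open>s\<^sup>2 = F\<^sub>n\<^sub>+\<^sub>2(x)\<close>, which is no contraction in the supremum
  norm where \<open>F\<^sub>n\<close> is close to 1. It becomes one after weighting: with
  \<open>w(u) = \<surd>u (1 - \<surd>u)\<close>, a bound \<open>D\<^sub>n(x) \<le> c w(F\<^sub>n\<^sub>+\<^sub>1(x))\<close> for all \<open>x\<close> passes to \<open>n + 1\<close>
  with \<open>c\<close> multiplied by \<open>1 - (1 - s) / 4\<close> (lemma \<open>weight_contraction\<close>). The gain is lost only for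
  \<open>s\<close> near 1, and there \<open>D\<^sub>n\<^sub>+\<^sub>1(x) \<le> (1 - s)\<^sup>2\<close> holds for free because \<open>F\<^sub>n\<^sub>+\<^sub>1 \<le> 1\<close>. Balancing the two
  estimates improves \<open>c\<close> to \<open>c - c\<^sup>2 / 16\<close>, whence \<open>c = 16 / (n + 16)\<close> and \<open>D\<^sub>n \<le> 4 / (n + 16)\<close>
  (lemmas \<open>wave_increment_le_weight\<close> and \<open>wave_increment_bound\<close>).

  The passage from nearly stationary to nearly invariant is \<open>near_orbits_shadow_g\<close>. It is used on both
  sides of the median, since \<open>1 - G(y) = g(1 - y)\<close> turns the orbits of \<open>G\<close> below the median
  into orbits of \<open>g\<close>.
\<close>

section \<open>The tail recursion\<close>

primrec wave :: "nat \<Rightarrow> int \<Rightarrow> real" where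
  "wave 0 x = (if x \<le> 0 then 1 else 0)"
| "wave (Suc n) x = ((wave n x + wave n (x - 1)) / 2)\<^sup>2"

lemma wave_nonneg: "0 \<le> wave n x"
  by (cases n) auto

lemma wave_le_1: "wave n x \<le> 1"
proof (induction n arbitrary: x)
  case (Suc n)
  have "((wave n x + wave n (x - 1)) / 2)\<^sup>2 \<le> 1\<^sup>2"
    using Suc[of x] Suc[of "x - 1"] wave_nonneg[of n x] wave_nonneg[of n "x - 1"]
    by (intro power_mono) auto
  then show ?case by simp
qed auto

lemma wave_eq_1: "x \<le> 0 \<Longrightarrow> wave n x = 1"
  by (induction n arbitrary: x) auto

lemma wave_eq_0: "int n < x \<Longrightarrow> wave n x = 0"
  by (induction n arbitrary: x) auto

lemma wave_antimono: "x \<le> y \<Longrightarrow> wave n y \<le> wave n x"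
proof (induction n arbitrary: x y)
  case (Suc n)
  have "wave n y + wave n (y - 1) \<le> wave n x + wave n (x - 1)"
    using Suc.prems by (intro add_mono Suc.IH) auto
  then show ?case
    by (auto intro!: power_mono simp: wave_nonneg)
qed auto

text \<open>
  The tails grow with \<open>n\<close> because the recursion is monotone and its first step is upwards.
\<close>

lemma wave_le_Suc: "wave n x \<le> wave (Suc n) x"
proof (induction n arbitrary: x)
  case (Suc n)
  have "wave n x + wave n (x - 1) \<le> wave (Suc n) x + wave (Suc n) (x - 1)"
    by (intro add_mono Suc.IH)
  then have "((wave n x + wave n (x - 1)) / 2)\<^sup>2 \<le> ((wave (Suc n) x + wave (Suc n) (x - 1)) / 2)\<^sup>2"
    by (intro power_mono divide_right_mono) (auto simp: wave_nonneg add_nonneg_nonneg simp del: wave.simps)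
  then show ?case by (metis wave.simps(2))
qed auto

lemma sqrt_wave_Suc: "sqrt (wave (Suc n) x) = (wave n x + wave n (x - 1)) / 2"
  by (simp add: wave_nonneg add_nonneg_nonneg)

section \<open>Uniform decay of the increments\<close>

text \<open>
  The left side is \<open>w(u) + w(v)\<close> for \<open>u = a\<^sup>2\<close>, \<open>v = b\<^sup>2\<close> and \<open>w(u) = \<surd>u (1 - \<surd>u)\<close>, and \<open>1 - s\<close> is
  \<open>w(s\<^sup>2) / s\<close>. The weight is chosen so that the difference of \<open>1 - s\<close> and the left side is the sum of
  squares \<open>((1 - a)\<^sup>2 + (1 - b)\<^sup>2) / 2\<close>. As \<open>1 - s \<le> (1 - a) + (1 - b)\<close>, convexity bounds this below by
  \<open>(1 - s)\<^sup>2 / 4\<close>, which gives the factor by which the weighted increments contract.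
\<close>

lemma weight_contraction:
  fixes a b :: real
  assumes "0 \<le> a" "a \<le> 1" "0 \<le> b" "b \<le> 1"
  defines "s \<equiv> (a\<^sup>2 + b\<^sup>2) / 2"
  shows "a * (1 - a) + b * (1 - b) \<le> (1 - s) * (1 - (1 - s) / 4)"
proof -
  have s01: "0 \<le> 1 - s" "1 - s \<le> (1 - a) + (1 - b)"
  proof -
    have "a\<^sup>2 \<le> 1" "b\<^sup>2 \<le> 1" using assms by (auto intro: power_le_one)
    then show "0 \<le> 1 - s" by (simp add: s_def)
    have "((1 - a) + (1 - b)) - (1 - s) = ((1 - a)\<^sup>2 + (1 - b)\<^sup>2) / 2"
      by (simp add: s_def power2_eq_square field_simps)
    moreover have "((1 - a)\<^sup>2 + (1 - b)\<^sup>2) / 2 \<ge> 0" by simp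
    ultimately show "1 - s \<le> (1 - a) + (1 - b)" by linarith
  qed
  have "(1 - s)\<^sup>2 \<le> ((1 - a) + (1 - b))\<^sup>2"
    using s01 by (intro power_mono) auto
  also have "\<dots> \<le> 2 * ((1 - a)\<^sup>2 + (1 - b)\<^sup>2)"
    using zero_le_power2[of "(1 - a) - (1 - b)"] by (simp add: power2_eq_square algebra_simps)
  finally have "(1 - s)\<^sup>2 / 4 \<le> ((1 - a)\<^sup>2 + (1 - b)\<^sup>2) / 2"
    by simp
  moreover have "a * (1 - a) + b * (1 - b) = (1 - s) - ((1 - a)\<^sup>2 + (1 - b)\<^sup>2) / 2"
    by (simp add: s_def power2_eq_square field_simps)
  moreover have "(1 - s) * (1 - (1 - s) / 4) = (1 - s) - (1 - s)\<^sup>2 / 4"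
    by (simp add: power2_eq_square field_simps)
  ultimately show ?thesis by linarith
qed

text \<open>
  With \<open>s = \<surd>F\<^sub>n\<^sub>+\<^sub>1(x)\<close>, the bound \<open>F\<^sub>n(x - 1) \<le> 1\<close> gives \<open>F\<^sub>n(x) \<ge> 2 s - 1\<close>. This controls the increments
  where the tail is near 1 and the contraction degenerates.
\<close>

lemma wave_increment_le_square:
  "wave (Suc n) x - wave n x \<le> (1 - sqrt (wave (Suc n) x))\<^sup>2"
proof -
  define s where "s = (wave n x + wave n (x - 1)) / 2"
  have "wave n x \<ge> 2 * s - 1" using wave_le_1[of n "x - 1"] unfolding s_def by argo
  moreover have "wave (Suc n) x = s\<^sup>2" by (simp add: s_def)
  moreover have "sqrt (wave (Suc n) x) = s" unfolding s_def by (rule sqrt_wave_Suc)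
  ultimately show ?thesis by (simp add: power2_eq_square algebra_simps)
qed

text \<open>
  The constants come from the recursion \<open>c \<mapsto> c - c\<^sup>2 / 16\<close>, which is dominated by
  \<open>16 / (n + 16)\<close> and starts at \<open>1\<close>: the only increment at time 0 is \<open>1 / 4\<close>, at \<open>x = 1\<close>, and there the
  weight is \<open>1 / 4\<close> as well. The weight is taken at the later time because the square roots of the later
  tails are what enters the recursion for the increments.
\<close>

lemma wave_increment_le_weight:
  "wave (Suc n) x - wave n x
     \<le> 16 / (real n + 16) * (sqrt (wave (Suc n) x) * (1 - sqrt (wave (Suc n) x)))"
proof (induction n arbitrary: x)
  case 0
  consider "x \<le> 0" | "x = 1" | "x \<ge> 2" by linarith
  then show ?case
    by cases (auto simp: power2_eq_square real_sqrt_divide)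
next
  case (Suc n)
  define c where "c = 16 / (real n + 16)"
  define s where "s = sqrt (wave (Suc (Suc n)) x)"
  define a where "a = sqrt (wave (Suc n) x)"
  define b where "b = sqrt (wave (Suc n) (x - 1))"
  define D where "D = wave (Suc (Suc n)) x - wave (Suc n) x"
  have c: "0 < c" "c \<le> 1" by (auto simp: c_def)
  have a: "0 \<le> a" "a \<le> 1" and b: "0 \<le> b" "b \<le> 1" and s: "0 \<le> s" "s \<le> 1"
    unfolding a_def b_def s_def using wave_nonneg wave_le_1 by (auto simp del: wave.simps)
  have s2: "s = (a\<^sup>2 + b\<^sup>2) / 2"
    unfolding s_def a_def b_def sqrt_wave_Suc[of "Suc n"]
    by (simp add: wave_nonneg del: wave.simps)
  have D_nonneg: "0 \<le> wave (Suc n) x - wave n x" "0 \<le> wave (Suc n) (x-1) - wave n (x-1)"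
    using wave_le_Suc[of n x] wave_le_Suc[of n "x - 1"] by (auto simp del: wave.simps)
  have "D \<le> s * ((wave (Suc n) x - wave n x) + (wave (Suc n) (x - 1) - wave n (x - 1)))"
  proof -
    define r where "r = sqrt (wave (Suc n) x)"
    have r: "r = (wave n x + wave n (x - 1)) / 2" unfolding r_def by (rule sqrt_wave_Suc)
    have s': "s = (wave (Suc n) x + wave (Suc n) (x - 1)) / 2"
      unfolding s_def by (rule sqrt_wave_Suc)
    have "r \<le> s" unfolding r s' using D_nonneg by (simp del: wave.simps)
    have "D = s\<^sup>2 - r\<^sup>2"
      unfolding D_def s_def r_def by (simp add: wave_nonneg del: wave.simps)
    also have "\<dots> = (s + r) * (s - r)" by (simp add: power2_eq_square algebra_simps)
    also have "\<dots> \<le> (2 * s) * (s - r)" using \<open>r \<le> s\<close> by (intro mult_right_mono) auto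
    also have "2 * (s - r) = (wave (Suc n) x - wave n x) + (wave (Suc n) (x - 1) - wave n (x - 1))"
      unfolding r s' by (simp add: field_simps del: wave.simps)
    then have "(2 * s) * (s - r) = s * ((wave (Suc n) x - wave n x) + (wave (Suc n) (x - 1) - wave n (x - 1)))"
      by (metis mult.assoc mult.commute)
    finally show ?thesis .
  qed
  also have "\<dots> \<le> s * (c * (a * (1 - a)) + c * (b * (1 - b)))"
    unfolding c_def a_def b_def using s by (intro mult_left_mono add_mono Suc.IH) auto
  also have "\<dots> = c * s * (a * (1 - a) + b * (1 - b))" by (simp add: algebra_simps)
  also have "\<dots> \<le> c * s * ((1 - s) * (1 - (1 - s) / 4))"
    using weight_contraction[OF a b] c s unfolding s2[symmetric] by (intro mult_left_mono) auto
  finally have D1: "D \<le> c * (1 - (1 - s) / 4) * (s * (1 - s))" by (simp add: algebra_simps)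
  have D2: "D \<le> (1 - s) * (1 - s)"
    using wave_increment_le_square[of "Suc n" x] unfolding D_def s_def power2_eq_square .
  \<comment> \<open>Away from 1 the contraction gains the factor; near 1, where \<open>s \<ge> 3/4\<close>, the quadratic bound wins.\<close>
  have "D \<le> c * (1 - c / 16) * (s * (1 - s))"
  proof (cases "c / 4 \<le> 1 - s")
    case True
    have "c * (1 - (1 - s) / 4) \<le> c * (1 - c / 16)"
      using True c by (intro mult_left_mono) auto
    then have "c * (1 - (1 - s) / 4) * (s * (1 - s)) \<le> c * (1 - c / 16) * (s * (1 - s))"
      using s by (intro mult_right_mono) auto
    then show ?thesis using D1 by linarith
  next
    case False
    have "1 - s \<le> c * (1 - c / 16) * s"
    proof -
      have "3/4 \<le> s" using False c by linarith
      have "1 - s \<le> c * (15/16 * (3/4))" using False c by linarith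
      also have "\<dots> \<le> c * ((1 - c / 16) * s)"
        using c \<open>3/4 \<le> s\<close> by (intro mult_left_mono mult_mono) auto
      finally show ?thesis by (simp add: mult.assoc)
    qed
    then have "(1 - s) * (1 - s) \<le> c * (1 - c / 16) * s * (1 - s)"
      using s by (intro mult_right_mono) auto
    then show ?thesis using D2 by (simp add: mult.assoc)
  qed
  also have "\<dots> \<le> 16 / (real (Suc n) + 16) * (s * (1 - s))"
  proof -
    have "c * (1 - c / 16) \<le> 16 / (real (Suc n) + 16)"
      unfolding c_def by (simp add: divide_simps) (simp add: algebra_simps)
    then show ?thesis using s by (intro mult_right_mono) auto
  qed
  finally show ?case unfolding D_def s_def .
qed

lemma wave_increment_bound: "wave (Suc n) x - wave n x \<le> 4 / (real n + 16)"
proof -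
  define r where "r = sqrt (wave (Suc n) x)"
  have "r * (1 - r) \<le> 1 / 4"
    using zero_le_power2[of "r - 1/2"] by (simp add: power2_eq_square algebra_simps)
  then have "16 / (real n + 16) * (r * (1 - r)) \<le> 16 / (real n + 16) * (1 / 4)"
    by (intro mult_left_mono) auto
  also have "\<dots> = 4 / (real n + 16)" by (simp add: divide_simps)
  finally show ?thesis
    using wave_increment_le_weight[of n x] unfolding r_def by linarith
qed

section \<open>The maps \<open>g\<close> and \<open>G\<close> and their orbits\<close>

lemma abs_sqrt_diff_le: "\<bar>sqrt y - sqrt z\<bar> \<le> sqrt \<bar>y - z\<bar>" if "0 \<le> y" "0 \<le> z"
  for y z :: real
proof -
  have *: "sqrt y - sqrt z \<le> sqrt (y - z)" if "0 \<le> z" "z \<le> y" for y z :: real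
    using sqrt_add_le_add_sqrt[of z "y - z"] that by simp
  show ?thesis
    using *[of z y] *[of y z] that by (cases "z \<le> y") (auto simp: abs_minus_commute)
qed

text \<open>
  Reflecting the unit interval exchanges the two maps, so estimates for \<open>g\<close> near 0 serve for \<open>G\<close>
  near 1.
\<close>

lemma one_minus_G: "1 - G y = g (1 - y)"
  by (simp add: G_def g_def)

lemma one_minus_G_iterate: "1 - (G ^^ j) y = (g ^^ j) (1 - y)"
proof (induction j)
  case (Suc j)
  then show ?case using one_minus_G[of "(G ^^ j) y"] by simp
qed simp

lemma g_eq_square: "y \<le> 1 \<Longrightarrow> g y = (1 - sqrt (1 - y))\<^sup>2"
  by (simp add: g_def power2_eq_square algebra_simps)

lemma g_unit: "0 \<le> y \<Longrightarrow> y \<le> 1 \<Longrightarrow> 0 \<le> g y \<and> g y \<le> 1"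
  by (auto simp: g_eq_square intro!: power_le_one)

text \<open>
  Orbits of \<open>g\<close> that start below a constant less than 1 decay at least geometrically, by this bound.
\<close>

lemma g_le_square: 
  assumes "0 \<le> y" "y \<le> 1" shows "g y \<le> y\<^sup>2"
proof -
  have "1 - y \<le> sqrt (1 - y)"
    using assms by (intro real_le_rsqrt) (auto simp: power2_eq_square mult_left_le)
  then show ?thesis
    using assms unfolding g_eq_square[OF assms(2)] by (intro power_mono) auto
qed

lemma g_G: "0 \<le> y \<Longrightarrow> y \<le> 1 \<Longrightarrow> g (G y) = y"
proof -
  assume y: "0 \<le> y" "y \<le> 1"
  have "1 - G y = (1 - sqrt y)\<^sup>2"
    using y by (simp add: G_def power2_eq_square algebra_simps)
  then have "sqrt (1 - G y) = 1 - sqrt y" using y by simp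
  then show ?thesis by (simp add: g_def G_def)
qed

lemma G_unit: "0 \<le> y \<Longrightarrow> y \<le> 1 \<Longrightarrow> 0 \<le> G y \<and> G y \<le> 1"
  using one_minus_G[of y] g_unit[of "1 - y"] by auto

lemma G_iterate_unit: "0 \<le> y \<Longrightarrow> y \<le> 1 \<Longrightarrow> 0 \<le> (G ^^ j) y \<and> (G ^^ j) y \<le> 1"
  by (induction j) (auto simp: G_unit)

lemma g_iterate_G_iterate: "0 \<le> y \<Longrightarrow> y \<le> 1 \<Longrightarrow> (g ^^ j) ((G ^^ j) y) = y"
proof (induction j)
  case (Suc j)
  have "(g ^^ Suc j) ((G ^^ Suc j) y) = (g ^^ j) (g (G ((G ^^ j) y)))"
    by (simp add: funpow_swap1)
  then show ?case using Suc G_iterate_unit[of y j] by (simp add: g_G)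
qed simp

text \<open>
  The square root makes \<open>g\<close> only Hoelder continuous at 1, but with a modulus that is uniform on the
  unit interval, which is what following an orbit for finitely many steps needs.
\<close>

lemma g_holder:
  assumes "y \<le> 1" "z \<le> 1"
  shows "\<bar>g y - g z\<bar> \<le> \<bar>y - z\<bar> + 2 * sqrt \<bar>y - z\<bar>"
proof -
  have "\<bar>sqrt (1 - y) - sqrt (1 - z)\<bar> \<le> sqrt \<bar>y - z\<bar>"
    using abs_sqrt_diff_le[of "1 - y" "1 - z"] assms by (simp add: abs_minus_commute)
  then show ?thesis unfolding g_def by linarith
qed

text \<open>
  Passing the value \<open>b\<close> at \<open>k\<close> back to 0 by \<open>G\<close> and then moving along the orbit is the same as moving
  from \<open>b\<close> directly, because \<open>g\<close> undoes \<open>G\<close>.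
\<close>

lemma invariant_tail_above:
  assumes "0 \<le> b" "b \<le> 1"
  shows "invariant_tail ((G ^^ k) b) (int k + int j) = (g ^^ j) b"
proof (cases "int k + int j > 0")
  case True
  have "nat (int k + int j) = j + k" by simp
  then have "invariant_tail ((G ^^ k) b) (int k + int j) = (g ^^ j) ((g ^^ k) ((G ^^ k) b))"
    using True unfolding invariant_tail_def by (simp only: if_True funpow_add o_apply)
  then show ?thesis by (simp only: g_iterate_G_iterate[OF assms])
next
  case False
  then have "k = 0" "j = 0" by auto
  then show ?thesis by (simp add: invariant_tail_def)
qed

lemma invariant_tail_below:
  assumes "0 \<le> b" "b \<le> 1"
  shows "invariant_tail ((G ^^ k) b) (int k - int j) = (G ^^ j) b"
proof (cases "j < k")
  case True
  then have "(G ^^ k) b = (G ^^ (k - j)) ((G ^^ j) b)"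
    by (metis funpow_add o_apply le_add_diff_inverse2 less_imp_le)
  moreover have "nat (int k - int j) = k - j" by simp
  ultimately show ?thesis
    using True g_iterate_G_iterate[of "(G ^^ j) b" "k - j"] G_iterate_unit[OF assms, of j]
    by (simp add: invariant_tail_def)
next
  case False
  then have "invariant_tail ((G ^^ k) b) (int k - int j) = (G ^^ (j - k)) ((G ^^ k) b)"
    by (cases "j = k") (auto simp: invariant_tail_def nat_diff_distrib')
  also have "\<dots> = (G ^^ j) b"
    using False by (metis funpow_add o_apply le_add_diff_inverse2 not_less)
  finally show ?thesis .
qed

section \<open>Nearly stationary tails follow invariant tails\<close>

text \<open>
  The inner term is twice the root of the bound on the increments; the modulus of continuity of \<open>g\<close>
  is then applied to it.
\<close>

definition invariance_error :: "nat \<Rightarrow> real" where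
  "invariance_error n = (let h = 2 * sqrt (4 / (real n + 16)) in h + 2 * sqrt h)"

lemma invariance_error_tendsto_0: "invariance_error \<longlonglongrightarrow> 0"
proof -
  have "(\<lambda>n. 4 / (real n + 16)) \<longlonglongrightarrow> 0"
    by real_asymp
  then have h: "(\<lambda>n. 2 * sqrt (4 / (real n + 16))) \<longlonglongrightarrow> 0"
    using tendsto_mult_right_zero tendsto_real_sqrt by fastforce
  then have "(\<lambda>n. sqrt (2 * sqrt (4 / (real n + 16)))) \<longlonglongrightarrow> 0"
    using tendsto_real_sqrt by fastforce
  then show ?thesis
    unfolding invariance_error_def Let_def using tendsto_add[OF h tendsto_mult_right_zero] by fastforce
qed

text \<open>
  The defect \<open>F\<^sub>n(x - 1) - G(F\<^sub>n(x))\<close> equals \<open>2 (\<surd>F\<^sub>n\<^sub>+\<^sub>1(x) - \<surd>F\<^sub>n(x))\<close>, hence is small with the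
  increment. Applying \<open>g\<close>, which undoes \<open>G\<close>, gives the second bound.
\<close>

lemma wave_nearly_invariant:
  shows "\<bar>wave n (x - 1) - G (wave n x)\<bar> \<le> invariance_error n"
    and "\<bar>wave n x - g (wave n (x - 1))\<bar> \<le> invariance_error n"
proof -
  define h where "h = 2 * sqrt (4 / (real n + 16))"
  have h: "0 \<le> h" by (simp add: h_def)
  have "\<bar>sqrt (wave (Suc n) x) - sqrt (wave n x)\<bar> \<le> sqrt \<bar>wave (Suc n) x - wave n x\<bar>"
    by (intro abs_sqrt_diff_le wave_nonneg)
  also have "\<dots> \<le> sqrt (4 / (real n + 16))"
    using wave_increment_bound[of n x] wave_le_Suc[of n x] by (simp del: wave.simps)
  finally have "\<bar>2 * sqrt (wave (Suc n) x) - 2 * sqrt (wave n x)\<bar> \<le> h"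
    unfolding h_def by linarith
  then have 1: "\<bar>wave n (x - 1) - G (wave n x)\<bar> \<le> h"
    unfolding G_def sqrt_wave_Suc by (simp add: field_simps)
  then show "\<bar>wave n (x - 1) - G (wave n x)\<bar> \<le> invariance_error n"
    using h by (simp add: invariance_error_def h_def[symmetric] add_increasing2)
  have "\<bar>wave n x - g (wave n (x - 1))\<bar> = \<bar>g (G (wave n x)) - g (wave n (x - 1))\<bar>"
    by (simp add: g_G wave_nonneg wave_le_1)
  also have "\<dots> \<le> \<bar>G (wave n x) - wave n (x - 1)\<bar> + 2 * sqrt \<bar>G (wave n x) - wave n (x - 1)\<bar>"
    by (intro g_holder) (auto simp: G_unit wave_nonneg wave_le_1)
  also have "\<dots> \<le> h + 2 * sqrt h"
    using 1 by (intro add_mono mult_left_mono) (auto simp: abs_minus_commute)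
  finally show "\<bar>wave n x - g (wave n (x - 1))\<bar> \<le> invariance_error n"
    by (simp add: invariance_error_def h_def[symmetric])
qed

lemma g_iterate_le_geometric:
  assumes "0 \<le> y" "y \<le> \<rho>" "\<rho> \<le> 1"
  shows "0 \<le> (g ^^ j) y \<and> (g ^^ j) y \<le> \<rho> ^ Suc j"
proof (induction j)
  case (Suc j)
  define z where "z = (g ^^ j) y"
  have z: "0 \<le> z" "z \<le> \<rho> ^ Suc j" using Suc by (auto simp: z_def)
  have \<rho>: "0 \<le> \<rho>" using assms by linarith
  have z\<rho>: "z \<le> \<rho>" using z(2) \<rho> assms(3) 
    by (metis power_decreasing power_one_right le_add2 order_trans plus_1_eq_Suc le_add1)
  have "g z \<le> z * z" using g_le_square[of z] z z\<rho> assms by (simp add: power2_eq_square)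
  also have "\<dots> \<le> \<rho> * \<rho> ^ Suc j" using z z\<rho> \<rho> by (intro mult_mono) auto
  finally show ?case using g_unit[of z] z z\<rho> assms by (simp add: z_def)
qed (use assms in auto)

text \<open>
  Over a fixed number of steps the errors add up to something that vanishes as \<open>n \<rightarrow> \<infinity>\<close>, by continuity
  of \<open>g\<close>. All later steps are handled at once: the orbit has become small, uniformly in the starting
  point below \<open>\<rho>\<close>, so \<open>\<phi> n\<close> is small at that step and stays so by monotonicity.
\<close>

lemma near_orbits_shadow_g:
  fixes \<phi> :: "nat \<Rightarrow> nat \<Rightarrow> real"
  assumes unit: "\<And>n j. 0 \<le> \<phi> n j \<and> \<phi> n j \<le> 1"
    and anti: "\<And>n i j. i \<le> j \<Longrightarrow> \<phi> n j \<le> \<phi> n i"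
    and start: "eventually (\<lambda>n. \<phi> n 0 \<le> \<rho>) sequentially" and \<rho>: "0 \<le> \<rho>" "\<rho> < 1"
    and step: "\<And>n j. \<bar>\<phi> n (Suc j) - g (\<phi> n j)\<bar> \<le> h n" and h: "h \<longlonglongrightarrow> 0"
    and \<epsilon>: "0 < \<epsilon>"
  shows "eventually (\<lambda>n. \<forall>j. \<bar>\<phi> n j - (g ^^ j) (\<phi> n 0)\<bar> \<le> \<epsilon>) sequentially"
proof -
  have orbit: "0 \<le> (g ^^ j) (\<phi> n 0) \<and> (g ^^ j) (\<phi> n 0) \<le> 1" for n j
    using g_iterate_le_geometric[of "\<phi> n 0" 1 j] unit[of n 0] by simp
  have fixed: "(\<lambda>n. \<phi> n j - (g ^^ j) (\<phi> n 0)) \<longlonglongrightarrow> 0" for j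
  proof (induction j)
    case (Suc j)
    define d where "d n = \<bar>\<phi> n j - (g ^^ j) (\<phi> n 0)\<bar>" for n
    have d: "d \<longlonglongrightarrow> 0" unfolding d_def using Suc by (rule tendsto_rabs_zero)
    then have "(\<lambda>n. sqrt (d n)) \<longlonglongrightarrow> 0" using tendsto_real_sqrt by fastforce
    then have "(\<lambda>n. h n + (d n + 2 * sqrt (d n))) \<longlonglongrightarrow> 0"
      using h d by (auto intro!: tendsto_eq_intros)
    moreover have "norm (\<phi> n (Suc j) - (g ^^ Suc j) (\<phi> n 0)) \<le> h n + (d n + 2 * sqrt (d n))" for n
    proof -
      have "\<bar>g (\<phi> n j) - g ((g ^^ j) (\<phi> n 0))\<bar> \<le> d n + 2 * sqrt (d n)"
        unfolding d_def using unit[of n j] orbit[of j n] by (intro g_holder) auto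
      then show ?thesis using step[of n j] by simp
    qed
    ultimately show ?case by (rule Lim_null_comparison[OF eventuallyI, rotated])
  qed simp
  obtain J where J: "\<rho> ^ Suc J < \<epsilon> / 2"
  proof -
    obtain J where "\<rho> ^ J < \<epsilon> / 2" using real_arch_pow_inv[of "\<epsilon>/2" \<rho>] \<epsilon> \<rho> by auto
    moreover have "\<rho> ^ Suc J \<le> \<rho> ^ J" using \<rho> by (intro power_decreasing) auto
    ultimately have "\<rho> ^ Suc J < \<epsilon> / 2" by linarith
    then show ?thesis by (rule that)
  qed
  have "eventually (\<lambda>n. \<forall>j\<in>{..J}. \<bar>\<phi> n j - (g ^^ j) (\<phi> n 0)\<bar> < \<epsilon> / 2) sequentially"
  proof (intro eventually_ball_finite ballI)
    fix j show "eventually (\<lambda>n. \<bar>\<phi> n j - (g ^^ j) (\<phi> n 0)\<bar> < \<epsilon> / 2) sequentially"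
      using tendstoD[OF fixed[of j], of "\<epsilon>/2"] \<epsilon> by (simp add: dist_real_def)
  qed simp
  then show ?thesis using start
  proof eventually_elim
    case (elim n)
    show ?case
    proof
      fix j
      show "\<bar>\<phi> n j - (g ^^ j) (\<phi> n 0)\<bar> \<le> \<epsilon>"
      proof (cases "j \<le> J")
        case True
        then have "\<bar>\<phi> n j - (g ^^ j) (\<phi> n 0)\<bar> < \<epsilon> / 2" using elim(1) by simp
        then show ?thesis using \<epsilon> by linarith
      next
        case False
        have geo: "(g ^^ i) (\<phi> n 0) \<le> \<rho> ^ Suc i" for i
          using g_iterate_le_geometric[of "\<phi> n 0" \<rho> i] unit[of n 0] elim(2) \<rho> by auto
        have "(g ^^ j) (\<phi> n 0) \<le> \<rho> ^ Suc J"
          using geo[of j] power_decreasing[of "Suc J" "Suc j" \<rho>] False \<rho> by linarith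
        moreover have "\<bar>\<phi> n J - (g ^^ J) (\<phi> n 0)\<bar> < \<epsilon> / 2" using elim(1) by simp
        moreover have "\<phi> n j \<le> \<phi> n J" using anti False by simp
        ultimately show ?thesis
          using geo[of J] J orbit[of j n] unit[of n j] by linarith
      qed
    qed
  qed
qed

lemma wave_median:
  obtains k :: nat where "Inf {x. wave n x \<le> 1/2} = int k" "wave n (int k) \<le> 1/2"
    "wave n (int k - 1) > 1/2"
proof -
  define k where "k = (LEAST i. wave n (int i) \<le> 1/2)"
  have "wave n (int (Suc n)) \<le> 1/2" using wave_eq_0[of n "int (Suc n)"] by simp
  then have k: "wave n (int k) \<le> 1/2" unfolding k_def by (rule LeastI)
  have below: "wave n x > 1/2" if "x < int k" for x
  proof (cases "x \<le> 0")
    case False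
    then have "nat x < k" using that by simp
    then have "\<not> wave n (int (nat x)) \<le> 1/2" unfolding k_def by (rule not_less_Least)
    then show ?thesis using False by simp
  qed (simp add: wave_eq_1)
  have "Inf {x. wave n x \<le> 1/2} = int k"
    using k below by (intro cInf_eq_minimum) (auto simp: not_less[symmetric])
  then show ?thesis using that k below by auto
qed

text \<open>
  Upwards from the median the values of \<open>F\<^sub>n\<close> follow \<open>g\<close>, and downwards the values of \<open>1 - F\<^sub>n\<close> do. Both
  start below a constant less than 1: the former at most at \<open>1/2\<close>, and the latter eventually below
  \<open>31/32\<close>, because the tail at the median cannot lag far behind its value at the next time, which
  exceeds \<open>1/16\<close>.
\<close>

lemma wave_uniformly_close:
  assumes med: "\<And>n. wave n (int (k n)) \<le> 1/2" "\<And>n. wave n (int (k n) - 1) > 1/2"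
    and \<epsilon>: "0 < \<epsilon>"
  shows "eventually (\<lambda>n. \<forall>x. \<bar>wave n x - invariant_tail ((G ^^ k n) (wave n (int (k n)))) x\<bar> \<le> \<epsilon>)
    sequentially"
proof -
  have "eventually (\<lambda>n. \<forall>j. \<bar>wave n (int (k n) + int j) - (g ^^ j) (wave n (int (k n) + int 0))\<bar> \<le> \<epsilon>) sequentially"
  proof (rule near_orbits_shadow_g[where \<rho> = "1/2", OF _ _ _ _ _ _ invariance_error_tendsto_0 \<epsilon>])
    show "\<bar>wave n (int (k n) + int (Suc j)) - g (wave n (int (k n) + int j))\<bar> \<le> invariance_error n" for n j
      using wave_nearly_invariant(2)[of n "int (k n) + int (Suc j)"] by (simp add: algebra_simps)
  qed (use med in \<open>auto simp: wave_nonneg wave_le_1 wave_antimono\<close>)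
  moreover have "eventually (\<lambda>n. \<forall>j. \<bar>(1 - wave n (int (k n) - int j)) - (g ^^ j) (1 - wave n (int (k n) - int 0))\<bar> \<le> \<epsilon>) sequentially"
  proof (rule near_orbits_shadow_g[where \<rho> = "31/32", OF _ _ _ _ _ _ invariance_error_tendsto_0 \<epsilon>])
    show "\<bar>(1 - wave n (int (k n) - int (Suc j))) - g (1 - wave n (int (k n) - int j))\<bar> \<le> invariance_error n" for n j
      using wave_nearly_invariant(1)[of n "int (k n) - int j"]
      by (simp add: one_minus_G[symmetric] algebra_simps abs_minus_commute)
    have "eventually (\<lambda>n. 4 / (real n + 16) \<le> 1 / 32) sequentially" by real_asymp
    then show "eventually (\<lambda>n. 1 - wave n (int (k n) - int 0) \<le> 31/32) sequentially"
    proof eventually_elim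
      case (elim n)
      have "(1/4)\<^sup>2 \<le> wave (Suc n) (int (k n))"
        unfolding wave.simps using med(2)[of n] wave_nonneg[of n "int (k n)"]
        by (intro power_mono) auto
      then show ?case using wave_increment_bound[of n "int (k n)"] elim
        unfolding power2_eq_square of_nat_0 diff_zero by linarith
    qed
  qed (auto simp: wave_nonneg wave_le_1 wave_antimono)
  ultimately show ?thesis
  proof eventually_elim
    case (elim n)
    show ?case
    proof
      fix x
      define b where "b = wave n (int (k n))"
      have b: "0 \<le> b" "b \<le> 1" by (auto simp: b_def wave_nonneg wave_le_1)
      show "\<bar>wave n x - invariant_tail ((G ^^ k n) (wave n (int (k n)))) x\<bar> \<le> \<epsilon>"
      proof (cases "int (k n) \<le> x")
        case True
        then obtain j where x: "x = int (k n) + int j" using zle_iff_zadd by blast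
        show ?thesis
          using elim(1) invariant_tail_above[OF b, of "k n" j] unfolding x b_def by simp
      next
        case False
        then have x: "x = int (k n) - int (nat (int (k n) - x))" by simp
        define j where "j = nat (int (k n) - x)"
        have "\<bar>(1 - wave n (int (k n) - int j)) - (1 - (G ^^ j) b)\<bar> \<le> \<epsilon>"
          using elim(2) unfolding one_minus_G_iterate b_def by simp
        then show ?thesis
          using invariant_tail_below[OF b, of "k n" j] x unfolding j_def b_def by simp
      qed
    qed
  qed
qed

section \<open>Splitting the tree at the root\<close>

lemma position_Cons:
  "position B (c # u) \<omega> = B [c] \<omega> + position (\<lambda>e. B (c # e)) u \<omega>"
proof -
  have "position B (c # u) \<omega> = (\<Sum>i=0..length u. B (take (Suc i) (c # u)) \<omega>)"
    unfolding position_def by (subst sum.shift_bounds_cl_Suc_ivl[symmetric]) simp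
  also have "\<dots> = B [c] \<omega> + (\<Sum>i=1..length u. B (c # take i u) \<omega>)"
    by (subst sum.atLeast_Suc_atMost) auto
  finally show ?thesis by (simp add: position_def)
qed

lemma level_Suc:
  "{u :: bool list. length u = Suc n} = Cons False ` {u. length u = n} \<union> Cons True ` {u. length u = n}"
proof -
  have "u \<in> Cons False ` {u. length u = n} \<union> Cons True ` {u. length u = n}"
    if "length u = Suc n" for u :: "bool list"
    using that by (cases u; cases "hd u") auto
  then show ?thesis by auto
qed

lemma max_position_Suc:
  "max_position B (Suc n) \<omega> =
     max (B [False] \<omega> + max_position (\<lambda>e. B (False # e)) n \<omega>)
         (B [True] \<omega> + max_position (\<lambda>e. B (True # e)) n \<omega>)"
proof -
  define L where "L = {u :: bool list. length u = n}"
  have fin: "finite L" using finite_lists_length_eq[of "UNIV :: bool set" n] by (simp add: L_def)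
  have ne: "L \<noteq> {}" using Ex_list_of_length[of n] by (auto simp: L_def)
  have shift: "Max ((\<lambda>u. position B (c # u) \<omega>) ` L)
      = B [c] \<omega> + max_position (\<lambda>e. B (c # e)) n \<omega>" for c
  proof -
    have "mono (\<lambda>y. B [c] \<omega> + y)" by (intro monoI) simp
    from mono_Max_commute[OF this, of "(\<lambda>u. position (\<lambda>e. B (c # e)) u \<omega>) ` L"] show ?thesis
      using fin ne
      by (simp add: max_position_def position_Cons L_def image_image setcompr_eq_image)
  qed
  have "{position B u \<omega> | u. length u = Suc n}
      = (\<lambda>u. position B (False # u) \<omega>) ` L \<union> (\<lambda>u. position B (True # u) \<omega>) ` L"
    unfolding setcompr_eq_image level_Suc L_def by (simp add: image_Un image_image)
  then show ?thesis
    unfolding max_position_def[of B] using fin ne by (simp add: Max_Un shift)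
qed

text \<open>
  The first summand is the cost of the edge to the child \<open>c\<close>: 1 for a step \<open>-1\<close>, nothing for a step
  \<open>1\<close>. Hence the minimum over both children is the defect of the whole tree.
\<close>

definition branch_defect :: "(bool list \<Rightarrow> 'w \<Rightarrow> real) \<Rightarrow> nat \<Rightarrow> bool \<Rightarrow> 'w \<Rightarrow> real" where
  "branch_defect B n c \<omega> = (1 - B [c] \<omega>) / 2 + max_defect (\<lambda>e. B (c # e)) n \<omega>"

lemma max_defect_Suc:
  "max_defect B (Suc n) \<omega> = min (branch_defect B n False \<omega>) (branch_defect B n True \<omega>)"
  unfolding max_defect_def branch_defect_def max_position_Suc
  by (simp add: max_def min_def field_simps)

lemma max_defect_0: "max_defect B 0 \<omega> = 0"
  by (simp add: max_defect_def max_position_def position_def)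

lemma measurable_max_defect:
  assumes "\<And>e. e \<in> tree_edges \<Longrightarrow> B e \<in> borel_measurable N"
  shows "max_defect B n \<in> borel_measurable N"
  using assms
proof (induction n arbitrary: B)
  case 0
  then show ?case by (simp add: max_defect_0[abs_def])
next
  case (Suc n)
  have "branch_defect B n c \<in> borel_measurable N" for c
  proof -
    have "max_defect (\<lambda>e. B (c # e)) n \<in> borel_measurable N"
      by (intro Suc.IH Suc.prems) (auto simp: tree_edges_def)
    moreover have "B [c] \<in> borel_measurable N"
      by (intro Suc.prems) (auto simp: tree_edges_def)
    ultimately show ?thesis unfolding branch_defect_def by measurable
  qed
  then show ?case unfolding max_defect_Suc[abs_def] by measurable
qed

lemma measurable_branch_defect:
  assumes "\<And>e. B (c # e) \<in> borel_measurable N"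
  shows "branch_defect B n c \<in> borel_measurable N"
proof -
  have "max_defect (\<lambda>e. B (c # e)) n \<in> borel_measurable N"
    by (intro measurable_max_defect assms)
  then show ?thesis unfolding branch_defect_def using assms[of "[]"] by measurable
qed

section \<open>The law of the defect\<close>

context prob_space
begin

text \<open>
  Independence of blocks of coordinates, with one block for each new index, contains reindexing.
\<close>

lemma indep_vars_reindex_inj:
  assumes "indep_vars M' X I" "inj_on f L" "f ` L \<subseteq> I"
  shows "indep_vars (\<lambda>i. M' (f i)) (\<lambda>i. X (f i)) L"
proof -
  have "indep_vars (\<lambda>i. PiM {f i} M') (\<lambda>i \<omega>. restrict (\<lambda>k. X k \<omega>) {f i}) L"
    using assms
    by (intro indep_vars_restrict) (auto simp: disjoint_family_on_def inj_on_def)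
  from indep_vars_compose2[OF this, of "\<lambda>i h. h (f i)" "\<lambda>i. M' (f i)"] show ?thesis
    by (simp add: measurable_component_singleton)
qed

lemma prob_disjoint_blocks:
  fixes f1 f2 :: "('i \<Rightarrow> 'b::topological_space) \<Rightarrow> 'c::topological_space"
  assumes ind: "indep_vars (\<lambda>_. borel) X I" and AB: "A \<inter> B = {}" "A \<subseteq> I" "B \<subseteq> I"
    and f1: "f1 \<in> borel_measurable (PiM A (\<lambda>_. borel))"
    and f2: "f2 \<in> borel_measurable (PiM B (\<lambda>_. borel))"
    and S: "S \<in> sets borel" "T \<in> sets borel"
  shows "prob {\<omega> \<in> space M. f1 (restrict (\<lambda>i. X i \<omega>) A) \<in> S \<and> f2 (restrict (\<lambda>i. X i \<omega>) B) \<in> T}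
    = prob {\<omega> \<in> space M. f1 (restrict (\<lambda>i. X i \<omega>) A) \<in> S}
      * prob {\<omega> \<in> space M. f2 (restrict (\<lambda>i. X i \<omega>) B) \<in> T}"
  using indep_varD[OF indep_var_compose[OF indep_var_restrict[OF ind AB] f1 f2] S]
  by (simp add: vimage_def Int_def conj_commute comp_def)

definition fair_signs :: "(bool list \<Rightarrow> 'a \<Rightarrow> real) \<Rightarrow> bool" where
  "fair_signs B \<longleftrightarrow> indep_vars (\<lambda>_. borel) B tree_edges \<and>
     (\<forall>e\<in>tree_edges. \<P>(\<omega> in M. B e \<omega> = 1) = 1/2 \<and> \<P>(\<omega> in M. B e \<omega> = -1) = 1/2)"

lemma fair_signs_subtree: "fair_signs B \<Longrightarrow> fair_signs (\<lambda>e. B (c # e))"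
  unfolding fair_signs_def
  by (auto simp: tree_edges_def inj_on_def
    intro!: indep_vars_reindex_inj[where M' = "\<lambda>_. borel" and X = B and f = "Cons c"])

lemma fair_signs_measurable: "fair_signs B \<Longrightarrow> e \<in> tree_edges \<Longrightarrow> B e \<in> borel_measurable M"
  by (auto simp: fair_signs_def indep_vars_def)

text \<open>
  Conditioning on the first edge, which is independent of the rest of the branch, gives the average of
  the tails at \<open>x\<close> and \<open>x - 1\<close>.
\<close>

lemma tail_branch:
  assumes B: "fair_signs B"
  shows "\<P>(\<omega> in M. branch_defect B n c \<omega> \<ge> real_of_int x)
    = (tail M (\<lambda>e. B (c # e)) n x + tail M (\<lambda>e. B (c # e)) n (x - 1)) / 2"
proof -
  define D where "D = max_defect (\<lambda>e. B (c # e)) n"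
  have [measurable]: "B [c] \<in> borel_measurable M"
    by (intro fair_signs_measurable[OF B]) (simp add: tree_edges_def)
  have [measurable]: "D \<in> borel_measurable M" unfolding D_def
    by (intro measurable_max_defect fair_signs_measurable[OF fair_signs_subtree[OF B]])
  have half: "\<P>(\<omega> in M. B [c] \<omega> = 1) = 1/2" "\<P>(\<omega> in M. B [c] \<omega> = -1) = 1/2"
    using B by (auto simp: fair_signs_def tree_edges_def)
  \<comment> \<open>The defect of the subtree is written as a function of the coordinates in \<open>?K\<close>, so that it becomes
     a measurable function of a block of variables disjoint from the first edge.\<close>
  have indep: "\<P>(\<omega> in M. B [c] \<omega> = s \<and> D \<omega> \<ge> y)
      = \<P>(\<omega> in M. B [c] \<omega> = s) * \<P>(\<omega> in M. D \<omega> \<ge> y)" for s y :: real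
  proof -
    let ?K = "{c # e | e. e \<in> tree_edges}"
    have "(\<lambda>h. h [c]) \<in> borel_measurable (PiM {[c]} (\<lambda>_. borel :: real measure))"
      by (rule measurable_component_singleton) simp
    moreover have "max_defect (\<lambda>e h. h (c # e)) n \<in> borel_measurable (PiM ?K (\<lambda>_. borel))"
      by (intro measurable_max_defect measurable_component_singleton) auto
    ultimately have "prob {\<omega> \<in> space M. restrict (\<lambda>i. B i \<omega>) {[c]} [c] \<in> {s} \<and>
          max_defect (\<lambda>e h. h (c # e)) n (restrict (\<lambda>i. B i \<omega>) ?K) \<in> {y..}}
      = prob {\<omega> \<in> space M. restrict (\<lambda>i. B i \<omega>) {[c]} [c] \<in> {s}} *
        prob {\<omega> \<in> space M. max_defect (\<lambda>e h. h (c # e)) n (restrict (\<lambda>i. B i \<omega>) ?K) \<in> {y..}}"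
      using B by (intro prob_disjoint_blocks[where I = tree_edges])
        (auto simp: fair_signs_def tree_edges_def)
    moreover have "max_defect (\<lambda>e h. h (c # e)) n (restrict (\<lambda>i. B i \<omega>) ?K) = D \<omega>" for \<omega>
    proof -
      have "position (\<lambda>e h. h (c # e)) u (restrict (\<lambda>i. B i \<omega>) ?K) = position (\<lambda>e. B (c # e)) u \<omega>"
        for u
        unfolding position_def by (intro sum.cong) (auto simp: tree_edges_def)
      then show ?thesis by (simp add: D_def max_defect_def max_position_def)
    qed
    ultimately show ?thesis by simp
  qed
  have "AE \<omega> in M. B [c] \<omega> = 1 \<or> B [c] \<omega> = -1"
  proof -
    have "\<P>(\<omega> in M. B [c] \<omega> = 1 \<or> B [c] \<omega> = -1)
        = prob ({\<omega> \<in> space M. B [c] \<omega> = 1} \<union> {\<omega> \<in> space M. B [c] \<omega> = -1})"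
      by (intro arg_cong[where f = prob]) auto
    also have "\<dots> = \<P>(\<omega> in M. B [c] \<omega> = 1) + \<P>(\<omega> in M. B [c] \<omega> = -1)"
      by (intro finite_measure_Union) auto
    also have "\<dots> = 1" unfolding half by simp
    finally show ?thesis by (subst (asm) prob_Collect_eq_1) auto
  qed
  then have "\<P>(\<omega> in M. branch_defect B n c \<omega> \<ge> real_of_int x)
      = prob ({\<omega> \<in> space M. B [c] \<omega> = 1 \<and> D \<omega> \<ge> x} \<union> {\<omega> \<in> space M. B [c] \<omega> = -1 \<and> D \<omega> \<ge> x - 1})"
    unfolding branch_defect_def D_def[symmetric]
    by (intro finite_measure_eq_AE) (auto elim!: eventually_mono)
  also have "\<dots> = \<P>(\<omega> in M. B [c] \<omega> = 1 \<and> D \<omega> \<ge> x) + \<P>(\<omega> in M. B [c] \<omega> = -1 \<and> D \<omega> \<ge> x - 1)"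
    by (intro finite_measure_Union) auto
  also have "\<dots> = (\<P>(\<omega> in M. D \<omega> \<ge> x) + \<P>(\<omega> in M. D \<omega> \<ge> x - 1)) / 2"
    unfolding indep half by (simp add: field_simps)
  finally show ?thesis by (simp add: tail_def D_def)
qed

text \<open>
  The two branches depend on disjoint sets of edges, and the defect is the minimum of theirs.
\<close>

lemma tail_Suc:
  assumes B: "fair_signs B"
  shows "tail M B (Suc n) x = (\<Prod>c\<in>UNIV. \<P>(\<omega> in M. branch_defect B n c \<omega> \<ge> real_of_int x))"
proof -
  let ?K = "\<lambda>c. range (Cons c) :: bool list set"
  let ?d = "\<lambda>c h. branch_defect (\<lambda>e h. h e) n c (h :: bool list \<Rightarrow> real)"
  have meas: "?d c \<in> borel_measurable (PiM (?K c) (\<lambda>_. borel))" for c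
    by (intro measurable_branch_defect measurable_component_singleton) auto
  have coord: "?d c (restrict (\<lambda>i. B i \<omega>) (?K c)) = branch_defect B n c \<omega>" for c \<omega>
    by (simp add: branch_defect_def max_defect_def max_position_def position_def)
  have "prob {\<omega> \<in> space M. ?d False (restrict (\<lambda>i. B i \<omega>) (?K False)) \<in> {real_of_int x..}
        \<and> ?d True (restrict (\<lambda>i. B i \<omega>) (?K True)) \<in> {real_of_int x..}}
    = prob {\<omega> \<in> space M. ?d False (restrict (\<lambda>i. B i \<omega>) (?K False)) \<in> {real_of_int x..}}
      * prob {\<omega> \<in> space M. ?d True (restrict (\<lambda>i. B i \<omega>) (?K True)) \<in> {real_of_int x..}}"
    using B by (intro prob_disjoint_blocks[where I = tree_edges] meas)
      (auto simp: fair_signs_def tree_edges_def)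
  then show ?thesis
    unfolding coord by (simp add: tail_def max_defect_Suc UNIV_bool)
qed

text \<open>
  The induction runs over all families of signs at once, because its step applies the hypothesis to
  the families on the two subtrees.
\<close>

lemma tail_eq_wave: "fair_signs B \<Longrightarrow> tail M B n x = wave n x"
proof (induction n arbitrary: B x)
  case 0
  then show ?case by (simp add: tail_def max_defect_0 prob_space)
next
  case (Suc n)
  then show ?case
    by (simp add: tail_Suc tail_branch fair_signs_subtree UNIV_bool power2_eq_square)
qed

end

theorem theorem4:
  fixes M :: "'w measure" and B :: "bool list \<Rightarrow> 'w \<Rightarrow> real"
  assumes "prob_space M"
    and "prob_space.indep_vars M (\<lambda>_. borel) B tree_edges"
    and "\<And>e. e \<in> tree_edges \<Longrightarrow> measure M {\<omega> \<in> space M. B e \<omega> = 1} = 1/2"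
    and "\<And>e. e \<in> tree_edges \<Longrightarrow> measure M {\<omega> \<in> space M. B e \<omega> = -1} = 1/2"
  shows "(\<lambda>n. SUP x::int. \<bar>tail M B n x - invariant_tail (tail_param M B n) x\<bar>)
           \<longlonglongrightarrow> 0"
proof -
  interpret prob_space M by fact
  have "fair_signs B" using assms by (simp add: fair_signs_def)
  then have tail: "tail M B n x = wave n x" for n x by (rule tail_eq_wave)
  have "\<exists>k. \<forall>n. tail_median M B n = int (k n) \<and> wave n (int (k n)) \<le> 1/2 \<and> wave n (int (k n) - 1) > 1/2"
    unfolding tail_median_def tail using wave_median by (intro choice) metis
  then obtain k where k: "\<And>n. tail_median M B n = int (k n)"
    "\<And>n. wave n (int (k n)) \<le> 1/2" "\<And>n. wave n (int (k n) - 1) > 1/2" by blast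
  have param: "tail_param M B n = (G ^^ k n) (wave n (int (k n)))" for n
    by (simp add: tail_param_def tail k(1))
  show ?thesis
  proof (rule tendstoI)
    fix \<epsilon> :: real assume "0 < \<epsilon>"
    then have "eventually (\<lambda>n. \<forall>x. \<bar>wave n x - invariant_tail ((G ^^ k n) (wave n (int (k n)))) x\<bar> \<le> \<epsilon> / 2)
        sequentially"
      by (intro wave_uniformly_close k) simp
    then show "eventually (\<lambda>n. dist (SUP x. \<bar>tail M B n x - invariant_tail (tail_param M B n) x\<bar>) 0 < \<epsilon>)
        sequentially"
    proof eventually_elim
      case (elim n)
      define f where "f x = \<bar>tail M B n x - invariant_tail (tail_param M B n) x\<bar>" for x
      have f: "f x \<le> \<epsilon> / 2" for x using elim by (simp add: f_def tail param)
      have "(SUP x. f x) \<le> \<epsilon> / 2" by (intro cSUP_least f) simp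
      moreover have "0 \<le> (SUP x. f x)"
      proof -
        have "bdd_above (range f)" using f by (intro bdd_aboveI2)
        then have "f 0 \<le> (SUP x. f x)" by (intro cSUP_upper) auto
        moreover have "0 \<le> f 0" by (simp add: f_def)
        ultimately show ?thesis by linarith
      qed
      ultimately show ?case using \<open>0 < \<epsilon>\<close> by (simp add: f_def)
    qed
  qed
qed

end
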